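(* Consider the lossless ($\boldsymbol\sigma\equiv 0$) semidiscrete full-wave Maxwell equations expressed in the electric and magnetic voltages, i.e. $\mathbf{M}\frac{\mathrm d}{\mathrm dt}\mathbf{x}(t)+\mathbf{K}\mathbf{x}(t)=\mathbf{r}(t)$ with $\mathbf{x}^\top=[\mathbf{h}^\top,\mathbf{e}^\top]$, $\mathbf{r}^\top=[0,-\mathbf{j}_{\mathrm s}^\top]$ and $$\mathbf{M}=\begin{bmatrix}\mathbf{M}_\nu^{-1}&0\\0&\mathbf{M}_\varepsilon\end{bmatrix},\qquad \mathbf{K}=\begin{bmatrix}0&\mathbf{C}\\-\widetilde{\mathbf{C}}&0\end{bmatrix},$$ under the assumptions on the domain, the materials, the boundary conditions and the discretisation stated in the context. Then these equations are an explicit system of ordinary differential equations: in the unknowns $\bar{\mathbf{x}}^\top=[(\mathbf{M}_\nu^{-1/2}\mathbf{h})^\top,(\mathbf{M}_\varepsilon^{1/2}\mathbf{e})^\top]$ they read $$\frac{\mathrm d}{\mathrm dt}\bar{\mathbf{x}}(t)=\bar{\mathbf{K}}\bar{\mathbf{x}}(t)+\bar{\mathbf{r}}(t),\qquad \bar{\mathbf{x}}(t_0)=\bar{\mathbf{x}}_0,$$ $$\bar{\mathbf{K}}=\begin{bmatrix}0&-\mathbf{M}_\nu^{1/2}\mathbf{C}\mathbf{M}_\varepsilon^{-1/2}\\ \mathbf{M}_\varepsilon^{-1/2}\widetilde{\mathbf{C}}\mathbf{M}_\nu^{1/2}&0\end{bmatrix},\qquad \bar{\mathbf{r}}^\top=[0,-(\mathbf{M}_\varepsilon^{-1/2}\mathbf{j}_{\mathrm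 s})^\top].$$
   Context: Domain: $\Omega\subset\mathbb{R}^3$ is open, bounded, Lipschitz and contractible. Materials: the permittivity $\boldsymbol\varepsilon$ and permeability $\boldsymbol\mu$ are tensor fields $\Omega\to\mathbb{R}^{3\times3}$ depending only on space and positive definite on all of $\Omega$; $\boldsymbol\nu=\boldsymbol\mu^{-1}$ is the reluctivity. The conductivity is $\boldsymbol\sigma\equiv0$ here. The source current density $\vec J_{\mathrm s}$ is supported in a subdomain $\Omega_{\mathrm s}\subset\Omega$. Discretisation: $\Omega$ is decomposed by a primal grid and a staggered dual grid (Finite Integration Technique, or equivalently lowest-order Whitney finite elements); primal edges correspond to dual facets, primal facets to dual edges, primal nodes to dual volumes. The time-dependent vectors are: $\mathbf{e}$ (integrals of the electric field strength over primal edges), $\mathbf{h}$ (integrals of the magnetic field strength over dual edges), $\mathbf{j}_{\mathrm s}$ (given integrals of the source current density over dual facets). $\mathbf{C}$ is the primal discrete curl (edge-to-facet incidence matrix with entries in $\{-1,0,1\}$) and $\widetilde{\mathbf{C}}$ the dual discrete curl, with $\widetilde{\mathbf{C}}=\mathbf{C}^\top$. Boundary conditions: all degrees of freedom and operators are restricted to the subspace in which homogeneous electric (Dirichlet) boundary conditions are incorporated and superfluous objects outside the domain are removed; the relation $\widetilde{\mathbf{C}}=\mathbf{C}^\top$ persists. The material matrices $\mathbf{M}_\varepsilon$ (acting on primal edge quantities, electric flux $=\mathbf{M}_\varepsilon\mathbf{e}$) and $\mathbf{M}_\nu$ (acting on primal facet quantities, $\mathbf{h}=\mathbf{M}_\nu\mathbf{b}$,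 where $\mathbf{b}$ is the vector of magnetic fluxes) are symmetric positive definite, given that $\boldsymbol\varepsilon$ and $\boldsymbol\mu$ depend only on space and are positive definite on all of $\Omega$. The semidiscrete equations are Faraday's law $\mathbf{C}\mathbf{e}=-\frac{\mathrm d}{\mathrm dt}\mathbf{b}$ and Ampère's law $\widetilde{\mathbf{C}}\mathbf{h}=\frac{\mathrm d}{\mathrm dt}(\mathbf{M}_\varepsilon\mathbf{e})+\mathbf{j}_{\mathrm s}$. A linear system $\mathbf{M}\frac{\mathrm d}{\mathrm dt}\mathbf{x}+\mathbf{K}\mathbf{x}=\mathbf{r}$ is called a system of differential-algebraic equations if $\mathbf{M}$ is singular; otherwise it is a system of ordinary differential equations. *)

theory Defs
  imports "HOL-Analysis.Analysis"
begin

section \<open>Matrices and linear systems\<close>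

definition pos_def :: "real^'n^'n \<Rightarrow> bool" where
  "pos_def A \<longleftrightarrow> transpose A = A \<and> (\<forall>v. v \<noteq> 0 \<longrightarrow> 0 < v \<bullet> (A *v v))"

definition pos_semidef :: "real^'n^'n \<Rightarrow> bool" where
  "pos_semidef A \<longleftrightarrow> transpose A = A \<and> (\<forall>v. 0 \<le> v \<bullet> (A *v v))"

text \<open>The principal square root; only meaningful for positive semidefinite arguments.\<close>

definition matrix_sqrt :: "real^'n^'n \<Rightarrow> real^'n^'n" where
  "matrix_sqrt A = (THE B. pos_semidef B \<and> B ** B = A)"

definition block_vec :: "real^'m \<Rightarrow> real^'n \<Rightarrow> real^('m + 'n)" where
  "block_vec u v = (\<chi> i. case i of Inl k \<Rightarrow> u $ k | Inr k \<Rightarrow> v $ k)"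

definition block_mat ::
  "real^'m^'m \<Rightarrow> real^'n^'m \<Rightarrow> real^'m^'n \<Rightarrow> real^'n^'n \<Rightarrow> real^('m + 'n)^('m + 'n)" where
  "block_mat A B C D =
     (\<chi> i j. case i of
        Inl k \<Rightarrow> (case j of Inl l \<Rightarrow> A $ k $ l | Inr l \<Rightarrow> B $ k $ l)
      | Inr k \<Rightarrow> (case j of Inl l \<Rightarrow> C $ k $ l | Inr l \<Rightarrow> D $ k $ l))"

text \<open>\<open>M x' + K x = r\<close> on a time interval \<open>T\<close>; at end points belonging to \<open>T\<close> the
  derivative is one-sided.\<close>

definition solves_linear_system ::
  "real set \<Rightarrow> real^'n^'n \<Rightarrow> real^'n^'n \<Rightarrow> (real \<Rightarrow> real^'n) \<Rightarrow> (real \<Rightarrow> real^'n) \<Rightarrow> bool" where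
  "solves_linear_system T M K r x \<longleftrightarrow>
     (\<forall>t\<in>T. \<exists>x'. (x has_vector_derivative x') (at t within T) \<and> M *v x' + K *v x t = r t)"

definition solves_explicit_ode ::
  "real set \<Rightarrow> real^'n^'n \<Rightarrow> (real \<Rightarrow> real^'n) \<Rightarrow> (real \<Rightarrow> real^'n) \<Rightarrow> bool" where
  "solves_explicit_ode T K r x \<longleftrightarrow>
     (\<forall>t\<in>T. (x has_vector_derivative (K *v x t + r t)) (at t within T))"

text \<open>Classification of \<open>M x' + K x = r\<close>, which depends on the leading matrix \<open>M\<close> only.\<close>

definition is_dae_system :: "real^'n^'n \<Rightarrow> bool" where
  "is_dae_system M \<longleftrightarrow> \<not> invertible M"

definition is_ode_system :: "real^'n^'n \<Rightarrow> bool" where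
  "is_ode_system M \<longleftrightarrow> \<not> is_dae_system M"


section \<open>Domain and grids\<close>

text \<open>Near every boundary point, up to a change of orthonormal coordinates, the set is the
  strict subgraph of a Lipschitz function of two variables.\<close>

definition lipschitz_domain :: "(real^3) set \<Rightarrow> bool" where
  "lipschitz_domain \<Omega> \<longleftrightarrow>
     (\<forall>p\<in>frontier \<Omega>. \<exists>U (R :: real^3 \<Rightarrow> real^3) (\<phi> :: real^2 \<Rightarrow> real) L.
        open U \<and> p \<in> U \<and> orthogonal_transformation R \<and> L-lipschitz_on UNIV \<phi> \<and>
        \<Omega> \<inter> U = {x \<in> U. R x $ 3 < \<phi> (vector [R x $ 1, R x $ 2])})"

text \<open>An oriented curve is a path; a circuit is a cyclic list of curve labels, where the flag
  tells whether the curve is traversed along (\<open>True\<close>) or against its orientation.\<close>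

definition oriented :: "('a \<Rightarrow> real \<Rightarrow> real^3) \<Rightarrow> 'a \<times> bool \<Rightarrow> real \<Rightarrow> real^3" where
  "oriented \<gamma> c = (if snd c then \<gamma> (fst c) else reversepath (\<gamma> (fst c)))"

definition closed_circuit :: "('a \<Rightarrow> real \<Rightarrow> real^3) \<Rightarrow> ('a \<times> bool) list \<Rightarrow> bool" where
  "closed_circuit \<gamma> cs \<longleftrightarrow> cs \<noteq> [] \<and> distinct (map fst cs) \<and>
     (\<forall>i<length cs.
        pathfinish (oriented \<gamma> (cs ! i)) = pathstart (oriented \<gamma> (cs ! (Suc i mod length cs))))"

definition circuit_image :: "('a \<Rightarrow> real \<Rightarrow> real^3) \<Rightarrow> ('a \<times> bool) list \<Rightarrow> (real^3) set" where
  "circuit_image \<gamma> cs = (\<Union>c\<in>set cs. path_image (\<gamma> (fst c)))"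

definition incidence :: "('a \<times> bool) list \<Rightarrow> 'a \<Rightarrow> real" where
  "incidence cs a = (if (a, True) \<in> set cs then 1 else if (a, False) \<in> set cs then -1 else 0)"

text \<open>The primal grid consists of all cells of a decomposition of the closed domain, including
  those on the boundary; facets are oriented by their boundary circuit.\<close>

record ('n, 'a, 'b, 'v) primal_grid =
  node :: "'n \<Rightarrow> real^3"
  edge :: "'a \<Rightarrow> real \<Rightarrow> real^3"
  facet :: "'b \<Rightarrow> (real^3) set"
  circuit :: "'b \<Rightarrow> ('a \<times> bool) list"
  volume :: "'v \<Rightarrow> (real^3) set"

fun open_cell :: "('n, 'a, 'b, 'v) primal_grid \<Rightarrow> 'n + 'a + 'b + 'v \<Rightarrow> (real^3) set" where
  "open_cell G (Inl n) = {node G n}"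
| "open_cell G (Inr (Inl a)) =
     path_image (edge G a) - {pathstart (edge G a), pathfinish (edge G a)}"
| "open_cell G (Inr (Inr (Inl b))) = facet G b - circuit_image (edge G) (circuit G b)"
| "open_cell G (Inr (Inr (Inr v))) = interior (volume G v)"

definition primal_decomposition ::
  "(real^3) set \<Rightarrow> ('n::finite, 'a::finite, 'b::finite, 'v::finite) primal_grid \<Rightarrow> bool" where
  "primal_decomposition \<Omega> G \<longleftrightarrow>
     (\<forall>a. arc (edge G a) \<and> pathstart (edge G a) \<in> range (node G) \<and>
          pathfinish (edge G a) \<in> range (node G)) \<and>
     (\<forall>b. closed_circuit (edge G) (circuit G b) \<and>
          (\<exists>f g. homeomorphism (cball (0::real^2) 1) (facet G b) f g \<and>
                 f ` sphere 0 1 = circuit_image (edge G) (circuit G b))) \<and>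
     (\<forall>v. \<exists>f g B. homeomorphism (cball (0::real^3) 1) (volume G v) f g \<and>
                 f ` sphere 0 1 = (\<Union>b\<in>B. facet G b)) \<and>
     disjoint_family (open_cell G) \<and>
     (\<Union>c. open_cell G c) = closure \<Omega>"

text \<open>The dual grid is indexed by the primal objects its cells correspond to, after those on the
  boundary have been removed: dual nodes by primal volumes, dual edges by the primal facets and
  dual facets by the primal edges carrying a degree of freedom, dual volumes by primal nodes.
  Dual facets are surfaces parametrised over the unit square, which fixes the sign of fluxes.\<close>

record ('n, 'e, 'f, 'v) dual_grid =
  dual_node :: "'v \<Rightarrow> real^3"
  dual_edge :: "'f \<Rightarrow> real \<Rightarrow> real^3"
  dual_facet :: "'e \<Rightarrow> real^2 \<Rightarrow> real^3"
  dual_circuit :: "'e \<Rightarrow> ('f \<times> bool) list"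
  dual_volume :: "'n \<Rightarrow> (real^3) set"

text \<open>\<open>ie\<close> and \<open>jf\<close> embed the indices of degrees of freedom into the labels of all primal edges
  and facets; a homogeneous electric boundary condition eliminates exactly the edges and facets
  lying on the boundary.\<close>

definition dirichlet_dofs ::
  "(real^3) set \<Rightarrow> ('n, 'a, 'b, 'v) primal_grid \<Rightarrow> ('e \<Rightarrow> 'a) \<Rightarrow> ('f \<Rightarrow> 'b) \<Rightarrow> bool" where
  "dirichlet_dofs \<Omega> G ie jf \<longleftrightarrow>
     bij_betw ie UNIV {a. \<not> path_image (edge G a) \<subseteq> frontier \<Omega>} \<and>
     bij_betw jf UNIV {b. \<not> facet G b \<subseteq> frontier \<Omega>}"

definition staggered_dual ::
  "(real^3) set \<Rightarrow> ('n, 'a, 'b, 'v) primal_grid \<Rightarrow> ('f \<Rightarrow> 'b) \<Rightarrow>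
   ('n, 'e, 'f, 'v) dual_grid \<Rightarrow> bool" where
  "staggered_dual \<Omega> G jf D \<longleftrightarrow>
     (\<forall>f. arc (dual_edge D f) \<and>
          (\<exists>v w. v \<noteq> w \<and> facet G (jf f) \<subseteq> volume G v \<inter> volume G w \<and>
                 pathstart (dual_edge D f) = dual_node D v \<and>
                 pathfinish (dual_edge D f) = dual_node D w)) \<and>
     (\<forall>e. closed_circuit (dual_edge D) (dual_circuit D e) \<and>
          (\<exists>L. L-lipschitz_on (cbox 0 1) (dual_facet D e)) \<and>
          inj_on (dual_facet D e) (cbox 0 1) \<and>
          dual_facet D e ` frontier (cbox 0 1) =
            circuit_image (dual_edge D) (dual_circuit D e)) \<and>
     (\<forall>n. node G n \<in> dual_volume D n) \<and>
     (\<forall>n m. n \<noteq> m \<longrightarrow> interior (dual_volume D n) \<inter> interior (dual_volume D m) = {}) \<and>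
     (\<Union>n. dual_volume D n) = closure \<Omega>"

definition primal_curl ::
  "('n, 'a, 'b, 'v) primal_grid \<Rightarrow> ('e::finite \<Rightarrow> 'a) \<Rightarrow> ('f::finite \<Rightarrow> 'b) \<Rightarrow> real^'e^'f" where
  "primal_curl G ie jf = (\<chi> f e. incidence (circuit G (jf f)) (ie e))"

definition dual_curl :: "('n, 'e::finite, 'f::finite, 'v) dual_grid \<Rightarrow> real^'f^'e" where
  "dual_curl D = (\<chi> e f. incidence (dual_circuit D e) f)"

text \<open>Flux of a vector field through a surface parametrised over the unit square. A Lipschitz
  parametrisation is differentiable almost everywhere, so the remaining points do not matter.\<close>

definition flux :: "(real^3 \<Rightarrow> real^3) \<Rightarrow> (real^2 \<Rightarrow> real^3) \<Rightarrow> real" where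
  "flux J S = integral (cbox 0 1)
     (\<lambda>u. J (S u) \<bullet> cross3 (frechet_derivative S (at u) (axis 1 1))
                           (frechet_derivative S (at u) (axis 2 1)))"


section \<open>The lossless semidiscrete Maxwell setting\<close>

text \<open>The material matrices are constrained only through the properties \<open>M\<epsilon>\<close> and \<open>M\<nu>\<close>: the
  discretisation scheme inherits symmetry and positive definiteness from the material tensors.\<close>

locale lossless_maxwell_discretisation =
  fixes \<Omega> \<Omega>s :: "(real^3) set"
    and \<epsilon> \<mu> :: "real^3 \<Rightarrow> real^3^3"
    and Js :: "real \<Rightarrow> real^3 \<Rightarrow> real^3"
    and G :: "('n::finite, 'a::finite, 'b::finite, 'v::finite) primal_grid"
    and D :: "('n, 'e::finite, 'f::finite, 'v) dual_grid"
    and ie :: "'e \<Rightarrow> 'a"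
    and jf :: "'f \<Rightarrow> 'b"
    and C :: "real^'e^'f"
    and Ct :: "real^'f^'e"
    and M\<epsilon> :: "real^'e^'e"
    and M\<nu> :: "real^'f^'f"
    and js :: "real \<Rightarrow> real^'e"
  assumes domain: "open \<Omega>" "bounded \<Omega>" "lipschitz_domain \<Omega>" "contractible \<Omega>"
    and permittivity: "\<And>x. x \<in> \<Omega> \<Longrightarrow> pos_def (\<epsilon> x)"
    and permeability: "\<And>x. x \<in> \<Omega> \<Longrightarrow> pos_def (\<mu> x)"
    and source: "open \<Omega>s" "\<Omega>s \<subseteq> \<Omega>" "\<And>t x. x \<notin> \<Omega>s \<Longrightarrow> Js t x = 0"
    and grids: "primal_decomposition \<Omega> G" "dirichlet_dofs \<Omega> G ie jf" "staggered_dual \<Omega> G jf D"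
    and curls: "C = primal_curl G ie jf" "Ct = dual_curl D" "Ct = transpose C"
    and M\<epsilon>: "(\<forall>x\<in>\<Omega>. pos_def (\<epsilon> x)) \<Longrightarrow> pos_def M\<epsilon>"
    and M\<nu>: "(\<forall>x\<in>\<Omega>. pos_def (\<mu> x)) \<Longrightarrow> pos_def M\<nu>"
    and js: "\<And>t e. js t $ e = flux (Js t) (dual_facet D e)"

end

theory Submission
  imports Defs
begin

text \<open>With \<open>P = block_mat (M\<nu>\<^sup>-\<^sup>1\<^sup>/\<^sup>2) 0 0 (M\<epsilon>\<^sup>1\<^sup>/\<^sup>2)\<close> the leading matrix is \<open>M = P P\<close>, so multiplying
  \<open>M x' + K x = r\<close> by \<open>P\<^sup>-\<^sup>1\<close> gives the explicit system for \<open>P x\<close>. The square root of a positive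
  definite matrix is \<open>I - Y\<close> up to scaling, where \<open>Y\<close> is the fixed point of the contraction
  \<open>Y \<mapsto> (X + Y Y) / 2\<close> and \<open>X = I - c A\<close> has norm less than one for small \<open>c\<close>.\<close>

section \<open>The principal square root\<close>

lemma transpose_eq_iff_self_adjoint:
  fixes A :: "real^'n^'n"
  shows "transpose A = A \<longleftrightarrow> (\<forall>v w. v \<bullet> (A *v w) = (A *v v) \<bullet> w)"
proof
  assume "transpose A = A"
  then show "\<forall>v w. v \<bullet> (A *v w) = (A *v v) \<bullet> w"
    by (metis dot_lmul_matrix transpose_matrix_vector)
next
  assume "\<forall>v w. v \<bullet> (A *v w) = (A *v v) \<bullet> w"
  then have "(transpose A *v v) \<bullet> w = (A *v v) \<bullet> w" for v w
    by (metis dot_lmul_matrix transpose_matrix_vector)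
  then show "transpose A = A"
    by (metis matrix_eq vector_eq_rdot)
qed

text \<open>Banach's theorem on the self-adjoint operators of norm at most \<open>q\<close>. This
  set is preserved because averages of operators in it stay in it, and the map has Lipschitz
  constant \<open>q\<close>. The fixed point equation amounts to
  \<open>(I - Y) (I - Y) = I - X\<close>.\<close>

lemma self_adjoint_quadratic_fixed_point:
  fixes X :: "'a::euclidean_space \<Rightarrow>\<^sub>L 'a"
  assumes X: "norm X \<le> q" "q < 1" "\<And>v w. v \<bullet> X w = X v \<bullet> w"
  obtains Y :: "'a \<Rightarrow>\<^sub>L 'a" where "norm Y \<le> q" "\<And>v w. v \<bullet> Y w = Y v \<bullet> w"
    "(1/2) *\<^sub>R (X + (Y o\<^sub>L Y)) = Y"
proof -
  define S where "S = {Y :: 'a \<Rightarrow>\<^sub>L 'a. norm Y \<le> q \<and>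
    (\<forall>v w. v \<bullet> blinfun_apply Y w = blinfun_apply Y v \<bullet> w)}"
  define F where "F = (\<lambda>Y :: 'a \<Rightarrow>\<^sub>L 'a. (1/2) *\<^sub>R (X + (Y o\<^sub>L Y)))"
  have q0: "0 \<le> q"
    using X(1) norm_ge_zero order_trans by blast
  have "closed S"
    unfolding S_def
    by (intro closed_Collect_conj closed_Collect_all closed_Collect_le closed_Collect_eq
          continuous_intros)
  then have "complete S"
    by (simp add: complete_eq_closed)
  moreover have "S \<noteq> {}"
    using X by (auto simp: S_def)
  moreover have "F ` S \<subseteq> S"
  proof
    fix Z assume "Z \<in> F ` S"
    then obtain Y where Z: "Z = F Y" and Y: "norm Y \<le> q" "\<And>v w. v \<bullet> Y w = Y v \<bullet> w"
      by (auto simp: S_def)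
    have "norm (Y o\<^sub>L Y) \<le> norm Y * norm Y"
      by (rule norm_blinfun_compose)
    also have "\<dots> \<le> q * 1"
      using Y(1) X(2) q0 by (intro mult_mono) auto
    finally have "norm (Y o\<^sub>L Y) \<le> q"
      by simp
    then have "norm Z \<le> q"
      using norm_triangle_ineq[of X "Y o\<^sub>L Y"] X(1) by (simp add: Z F_def)
    moreover have "v \<bullet> Z w = Z v \<bullet> w" for v w
      using X(3)[of v w] Y(2)[of v "Y w"] Y(2)[of "Y v" w]
      by (simp add: Z F_def blinfun.bilinear_simps inner_simps)
    ultimately show "Z \<in> S"
      by (simp add: S_def)
  qed
  moreover have "\<forall>Y\<in>S. \<forall>Z\<in>S. dist (F Y) (F Z) \<le> q * dist Y Z"
  proof (intro ballI)
    fix Y Z assume "Y \<in> S" "Z \<in> S"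
    then have YZ: "norm Y \<le> q" "norm Z \<le> q"
      by (auto simp: S_def)
    \<comment> \<open>Operators need not commute, so \<open>Y Y - Z Z\<close> is split as
      \<open>Y (Y - Z) + (Y - Z) Z\<close>.\<close>
    have "F Y - F Z = (1/2) *\<^sub>R ((Y o\<^sub>L (Y - Z)) + ((Y - Z) o\<^sub>L Z))"
      by (rule blinfun_eqI) (simp add: F_def blinfun.bilinear_simps algebra_simps)
    then have "dist (F Y) (F Z) \<le> (norm (Y o\<^sub>L (Y - Z)) + norm ((Y - Z) o\<^sub>L Z)) / 2"
      by (simp add: dist_norm norm_triangle_ineq)
    also have "\<dots> \<le> (norm Y * norm (Y - Z) + norm (Y - Z) * norm Z) / 2"
      by (intro divide_right_mono add_mono norm_blinfun_compose) auto
    also have "\<dots> \<le> (q * norm (Y - Z) + norm (Y - Z) * q) / 2"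
      using YZ by (intro divide_right_mono add_mono mult_right_mono mult_left_mono) auto
    finally show "dist (F Y) (F Z) \<le> q * dist Y Z"
      by (simp add: dist_norm mult.commute)
  qed
  ultimately obtain Y where "Y \<in> S" "F Y = Y"
    using Banach_fix[of S q F] q0 X(2) by blast
  then show ?thesis
    using that by (auto simp: S_def F_def)
qed

text \<open>The quadratic form attains a positive minimum on the compact unit sphere; being
  homogeneous of degree two, it is bounded below elsewhere by scaling.\<close>

lemma pos_def_coercive:
  fixes A :: "real^'n^'n"
  assumes "pos_def A"
  obtains m where "0 < m" "\<And>v. m * (norm v)\<^sup>2 \<le> v \<bullet> (A *v v)"
proof -
  have "sphere (0::real^'n) 1 \<noteq> {}"
    by simp
  moreover have "continuous_on (sphere 0 1) (\<lambda>v. v \<bullet> (A *v v))"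
    by (intro continuous_intros linear_continuous_on matrix_vector_mul_bounded_linear)
  ultimately obtain u where u: "u \<in> sphere 0 1"
      "\<And>v. v \<in> sphere 0 1 \<Longrightarrow> u \<bullet> (A *v u) \<le> v \<bullet> (A *v v)"
    using continuous_attains_inf[OF compact_sphere] by blast
  show ?thesis
  proof
    have "u \<noteq> 0"
      using u(1) by auto
    then show "0 < u \<bullet> (A *v u)"
      using assms by (simp add: pos_def_def)
    fix v :: "real^'n"
    show "(u \<bullet> (A *v u)) * (norm v)\<^sup>2 \<le> v \<bullet> (A *v v)"
    proof (cases "v = 0")
      case False
      then have "(v /\<^sub>R norm v) \<in> sphere 0 1"
        by simp
      from u(2)[OF this] False show ?thesis
        by (simp add: matrix_vector_mult_scaleR field_simps power2_eq_square)
    qed simp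
  qed
qed

lemma pos_def_sqrt_exists:
  fixes A :: "real^'n^'n"
  assumes A: "pos_def A"
  obtains B where "pos_def B" "B ** B = A"
proof -
  obtain m where m: "0 < m" "\<And>v. m * (norm v)\<^sup>2 \<le> v \<bullet> (A *v v)"
    using pos_def_coercive[OF A] by blast
  obtain L where L: "0 < L" "\<And>v. norm (A *v v) \<le> norm v * L"
    using bounded_linear.pos_bounded[OF matrix_vector_mul_bounded_linear, of A] by blast
  \<comment> \<open>This \<open>c\<close> minimises \<open>1 - 2 c m + c^2 L^2\<close>, the bound on
    the squared norm of \<open>I - c A\<close>; the minimum is \<open>1 - m^2 / L^2\<close>, the
    square of \<open>q\<close>.\<close>
  define c where "c = m / L\<^sup>2"
  define q where "q = sqrt (1 - m\<^sup>2 / L\<^sup>2)"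
  define X where "X = Blinfun (\<lambda>v. v - c *\<^sub>R (A *v v))"
  have c: "0 < c"
    using m L by (simp add: c_def)
  have X_apply: "blinfun_apply X = (\<lambda>v. v - c *\<^sub>R (A *v v))"
    unfolding X_def
    by (intro bounded_linear_Blinfun_apply bounded_linear_intros matrix_vector_mul_bounded_linear)
  have norm_sq: "(norm (X v))\<^sup>2 \<le> (1 - m\<^sup>2 / L\<^sup>2) * (norm v)\<^sup>2" for v
  proof -
    have "(norm (X v))\<^sup>2 = (norm v)\<^sup>2 - 2 * c * (v \<bullet> (A *v v)) + c\<^sup>2 * (norm (A *v v))\<^sup>2"
      unfolding X_apply power2_norm_eq_inner
      by (simp add: inner_diff_left inner_diff_right inner_commute[of "A *v v" v]
          power2_eq_square algebra_simps)
    also have "\<dots> \<le> (norm v)\<^sup>2 - 2 * c * (m * (norm v)\<^sup>2) + c\<^sup>2 * (norm v * L)\<^sup>2"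
      using m(2)[of v] c power_mono[OF L(2)[of v], of 2]
      by (intro add_mono diff_left_mono mult_left_mono) auto
    also have "\<dots> = (1 - m\<^sup>2 / L\<^sup>2) * (norm v)\<^sup>2"
      using L(1) by (simp add: c_def field_simps power2_eq_square)
    finally show ?thesis .
  qed
  have q: "0 \<le> 1 - m\<^sup>2 / L\<^sup>2" "q < 1"
  proof -
    \<comment> \<open>The bound is read at a unit vector; \<open>undefined\<close> stands for an
      arbitrary index.\<close>
    have "0 \<le> (1 - m\<^sup>2 / L\<^sup>2) * (norm (axis undefined 1 :: real^'n))\<^sup>2"
      by (rule order_trans[OF zero_le_power2 norm_sq])
    then show "0 \<le> 1 - m\<^sup>2 / L\<^sup>2"
      by simp
    show "q < 1"
      using m L by (simp add: q_def)
  qed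
  have "norm X \<le> q"
  proof (rule norm_blinfun_bound)
    show "norm (X v) \<le> q * norm v" for v
      using real_sqrt_le_mono[OF norm_sq[of v]] by (simp add: q_def real_sqrt_mult)
  qed (use q in \<open>simp add: q_def\<close>)
  moreover have A_sym: "v \<bullet> (A *v w) = (A *v v) \<bullet> w" for v w
    using A transpose_eq_iff_self_adjoint[of A] by (simp add: pos_def_def)
  then have "v \<bullet> X w = X v \<bullet> w" for v w
    by (simp add: X_apply inner_simps)
  ultimately obtain Y :: "(real^'n) \<Rightarrow>\<^sub>L (real^'n)" where
    Y: "norm Y \<le> q" "\<And>v w. v \<bullet> Y w = Y v \<bullet> w" "(1/2) *\<^sub>R (X + (Y o\<^sub>L Y)) = Y"
    using self_adjoint_quadratic_fixed_point[of X q] q(2) by blast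
  \<comment> \<open>\<open>I - Y\<close> is a root of \<open>I - X = c A\<close>, so dividing by
    \<open>sqrt c\<close> yields a root of \<open>A\<close>.\<close>
  define s where "s = 1 / sqrt c"
  have s: "0 < s" "s * s = 1 / c"
    using c by (simp_all add: s_def)
  define B where "B = matrix (\<lambda>v. s *\<^sub>R (v - Y v))"
  have B_apply: "B *v v = s *\<^sub>R (v - Y v)" for v
  proof -
    have "bounded_linear (\<lambda>v. s *\<^sub>R (v - Y v))"
      by (intro bounded_linear_intros)
    from matrix_vector_mul(3)[OF this] show ?thesis
      unfolding B_def by metis
  qed
  have "pos_def B"
    unfolding pos_def_def transpose_eq_iff_self_adjoint
  proof (intro conjI allI impI)
    show "v \<bullet> (B *v w) = (B *v v) \<bullet> w" for v w
      using Y(2)[of v w] by (simp add: B_apply inner_simps)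
    fix v :: "real^'n" assume v: "v \<noteq> 0"
    \<comment> \<open>Positivity of \<open>I - Y\<close> comes from
      \<open>norm Y \<le> q < 1\<close>.\<close>
    have "v \<bullet> Y v \<le> norm v * norm (Y v)"
      by (rule norm_cauchy_schwarz)
    also have "\<dots> \<le> norm v * (q * norm v)"
      using order_trans[OF norm_blinfun mult_right_mono[OF Y(1)]]
      by (intro mult_left_mono) auto
    also have "\<dots> < v \<bullet> v"
      using v q(2) by (simp add: power2_norm_eq_inner[symmetric] power2_eq_square)
    finally show "0 < v \<bullet> (B *v v)"
      using s(1) by (simp add: B_apply inner_simps)
  qed
  moreover have "B ** B = A"
  proof -
    have "(B ** B) *v v = A *v v" for v
    proof -
      have "2 *\<^sub>R Y = X + (Y o\<^sub>L Y)"
        using arg_cong[OF Y(3), of "(*\<^sub>R) 2"] by simp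
      from arg_cong[OF this, of "\<lambda>Z. blinfun_apply Z v"]
      have "Y v + Y v = X v + Y (Y v)"
        by (simp add: blinfun.bilinear_simps scaleR_2)
      then have "v - Y v - Y (v - Y v) = c *\<^sub>R (A *v v)"
        by (simp add: X_apply blinfun.bilinear_simps algebra_simps)
      moreover have "(B ** B) *v v = (1 / c) *\<^sub>R (v - Y v - Y (v - Y v))"
        by (simp add: matrix_vector_mul_assoc[symmetric] B_apply blinfun.bilinear_simps
            scaleR_diff_right scaleR_add_right s(2))
      ultimately show ?thesis
        using c by simp
    qed
    then show ?thesis
      by (simp add: matrix_eq)
  qed
  ultimately show ?thesis
    using that by blast
qed

section \<open>Uniqueness of the positive semidefinite square root\<close>

text \<open>Symmetry moves the left factor \<open>D\<close> across the inner product, so each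
  diagonal entry is a value of the quadratic form of \<open>B\<close>. Semidefiniteness of
  \<open>B\<close> thus gives the trace a sign.\<close>

lemma trace_sandwich:
  fixes B D :: "real^'n^'n"
  assumes "transpose D = D"
  shows "trace (D ** B ** D) = (\<Sum>i\<in>UNIV. (D *v axis i 1) \<bullet> (B *v (D *v axis i 1)))"
proof -
  have "(D ** B ** D) $ i $ i = (D *v axis i 1) \<bullet> (B *v (D *v axis i 1))" for i
  proof -
    have "(D ** B ** D) $ i $ i = axis i 1 \<bullet> ((D ** B ** D) *v axis i 1)"
      by (subst matrix_vector_mult_basis) (simp add: inner_axis' column_def)
    also have "\<dots> = axis i 1 \<bullet> (D *v (B *v (D *v axis i 1)))"
      by (simp only: matrix_vector_mul_assoc matrix_mul_assoc)
    also have "\<dots> = (D *v axis i 1) \<bullet> (B *v (D *v axis i 1))"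
      using assms transpose_eq_iff_self_adjoint by blast
    finally show ?thesis .
  qed
  then show ?thesis
    by (simp add: trace_def)
qed

text \<open>If \<open>B B = E E\<close> then \<open>D = B - E\<close> satisfies \<open>B D + D E = 0\<close>, so the traces of \<open>D B D\<close> and
  \<open>D E D\<close> cancel although both are nonnegative; this avoids simultaneous diagonalisation.\<close>

lemma psd_sqrt_unique:
  fixes B E :: "real^'n^'n"
  assumes B: "pos_def B" and E: "pos_semidef E" and eq: "B ** B = E ** E"
  shows "E = B"
proof -
  define D where "D = B - E"
  have D_apply: "D *v v = B *v v - E *v v" for v
    by (simp add: D_def matrix_vector_mult_diff_rdistrib)
  have sym: "transpose D = D"
    using B E unfolding pos_def_def pos_semidef_def transpose_eq_iff_self_adjoint
    by (simp add: D_apply inner_simps)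
  have "D ** B ** D + D ** D ** E = 0"
  proof (subst matrix_eq, intro allI)
    fix v
    have "B *v (B *v v) = E *v (E *v v)"
      using eq by (simp add: matrix_vector_mul_assoc)
    then have "B *v (D *v v) + D *v (E *v v) = 0"
      by (simp add: D_apply matrix_vector_mult_diff_distrib)
    then have "D *v (B *v (D *v v) + D *v (E *v v)) = 0"
      by simp
    then show "(D ** B ** D + D ** D ** E) *v v = 0 *v v"
      by (simp add: matrix_vector_mult_add_rdistrib matrix_vector_right_distrib
          matrix_vector_mul_assoc matrix_mul_assoc)
  qed
  then have "trace (D ** B ** D) + trace (D ** D ** E) = 0"
    by (metis trace_add trace_0 mat_0)
  \<comment> \<open>Cyclicity of the trace makes the second term a sandwich as well.\<close>
  moreover have "trace (D ** D ** E) = trace (D ** E ** D)"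
    by (metis matrix_mul_assoc trace_mul_sym)
  moreover have "0 \<le> trace (D ** E ** D)"
    using E by (simp add: trace_sandwich[OF sym] pos_semidef_def sum_nonneg)
  ultimately have le: "trace (D ** B ** D) \<le> 0"
    by simp
  have B_nonneg: "0 \<le> v \<bullet> (B *v v)" for v
    using B by (cases "v = 0") (auto simp: pos_def_def less_imp_le)
  \<comment> \<open>A sum of nonnegative terms that is at most zero has only zero terms; strict
    definiteness of \<open>B\<close> then kills every column of \<open>D\<close>.\<close>
  have "(D *v axis i 1) \<bullet> (B *v (D *v axis i 1)) = 0" for i
    using le B_nonneg
    by (simp add: trace_sandwich[OF sym] sum_nonneg sum_nonneg_eq_0_iff order_antisym_conv)
  then have "D *v axis i 1 = 0" for i
    using B unfolding pos_def_def by (metis less_irrefl)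
  then have "D = 0"
    by (simp add: matrix_vector_mult_basis column_def vec_eq_iff)
  then show ?thesis
    by (simp add: D_def)
qed

lemma pos_def_imp_pos_semidef: "pos_def A \<Longrightarrow> pos_semidef A"
  unfolding pos_def_def pos_semidef_def
  by (metis inner_zero_left less_imp_le order_refl)

text \<open>Existence and uniqueness together resolve the definite description. The root is even
  positive definite, hence invertible, as the change of unknowns requires.\<close>

lemma pos_def_matrix_sqrt:
  assumes "pos_def A"
  shows "pos_def (matrix_sqrt A)" and "matrix_sqrt A ** matrix_sqrt A = A"
proof -
  obtain B where B: "pos_def B" "B ** B = A"
    using pos_def_sqrt_exists[OF assms] .
  then have "matrix_sqrt A = B"
    unfolding matrix_sqrt_def
    by (intro the_equality conjI pos_def_imp_pos_semidef) (auto intro: psd_sqrt_unique)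
  with B show "pos_def (matrix_sqrt A)" and "matrix_sqrt A ** matrix_sqrt A = A"
    by auto
qed

section \<open>Change of unknowns\<close>

lemma matrix_inv_inverse:
  fixes A :: "real^'n^'n"
  assumes "invertible A"
  shows "A ** matrix_inv A = mat 1" and "matrix_inv A ** A = mat 1"
  using assms unfolding invertible_def matrix_inv_def by (metis (mono_tags, lifting) someI_ex)+

text \<open>A one-sided inverse of a square matrix is two-sided, so the choice in
  \<open>matrix_inv\<close> is forced.\<close>

lemma matrix_inv_unique:
  fixes A B :: "real^'n^'n"
  assumes "A ** B = mat 1"
  shows "matrix_inv A = B"
proof -
  have "invertible A"
    using assms invertible_right_inverse by blast
  then show ?thesis
    by (metis assms matrix_inv_inverse(2) matrix_mul_assoc matrix_mul_lid matrix_mul_rid)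
qed

lemma pos_def_invertible:
  fixes A :: "real^'n^'n"
  assumes "pos_def A"
  shows "invertible A"
  using assms unfolding invertible_left_inverse matrix_left_invertible_ker pos_def_def
  by (metis inner_zero_right less_irrefl)

lemma matrix_inv_square:
  fixes A :: "real^'n^'n"
  assumes "invertible A"
  shows "matrix_inv (A ** A) = matrix_inv A ** matrix_inv A"
  by (rule matrix_inv_unique)
    (metis assms matrix_inv_inverse(1) matrix_mul_assoc matrix_mul_rid)

text \<open>Multiplying by \<open>Q\<close> turns \<open>P P x' + K x = r\<close> into
  \<open>P x' = Q r - Q K Q (P x)\<close>. The constant matrices \<open>P\<close> and
  \<open>Q\<close> carry differentiability from \<open>x\<close> to \<open>P x\<close> and
  back.\<close>

lemma solves_linear_system_iff_explicit:
  fixes P Q K :: "real^'n^'n"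
  assumes PQ: "P ** Q = mat 1" and QP: "Q ** P = mat 1"
  shows "solves_linear_system T (P ** P) K r x \<longleftrightarrow>
    solves_explicit_ode T (- (Q ** K ** Q)) (\<lambda>t. Q *v r t) (\<lambda>t. P *v x t)"
proof -
  have inv: "P *v (Q *v v) = v" "Q *v (P *v v) = v" for v
    by (simp_all add: matrix_vector_mul_assoc PQ QP)
  have neg: "(- A) *v v = - (A *v v)" for A :: "real^'n^'n" and v
    by (metis diff_0 matrix_vector_mult_0 matrix_vector_mult_diff_rdistrib)
  have rhs: "(- (Q ** K ** Q)) *v (P *v x t) + Q *v r t = Q *v (r t - K *v x t)" for t
    by (simp add: neg matrix_vector_mul_assoc[symmetric] inv matrix_vector_mult_diff_distrib)
  have deriv: "((\<lambda>t. A *v y t) has_vector_derivative A *v y') F"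
    if "(y has_vector_derivative y') F" for A :: "real^'n^'n" and y y' F
    using bounded_linear.has_vector_derivative[OF matrix_vector_mul_bounded_linear that] .
  have "(\<exists>x'. (x has_vector_derivative x') (at t within T) \<and> (P ** P) *v x' + K *v x t = r t) \<longleftrightarrow>
    ((\<lambda>t. P *v x t) has_vector_derivative Q *v (r t - K *v x t)) (at t within T)"
    (is "?L \<longleftrightarrow> ?R") for t
  proof
    assume ?L
    then obtain x' where x': "(x has_vector_derivative x') (at t within T)"
        "P *v (P *v x') = r t - K *v x t"
      by (auto simp: matrix_vector_mul_assoc eq_diff_eq)
    then have "P *v x' = Q *v (r t - K *v x t)"
      by (metis inv(2))
    then show ?R
      using deriv[OF x'(1), of P] by simp
  next
    assume ?R
    \<comment> \<open>Here \<open>x\<close> is recovered as \<open>Q (P x)\<close> and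
      differentiated.\<close>
    then have "(x has_vector_derivative Q *v (Q *v (r t - K *v x t))) (at t within T)"
      using deriv[of "\<lambda>t. P *v x t" _ _ Q] by (simp add: inv)
    moreover have "(P ** P) *v (Q *v (Q *v (r t - K *v x t))) + K *v x t = r t"
      by (simp add: matrix_vector_mul_assoc[symmetric] inv)
    ultimately show ?L
      by blast
  qed
  then show ?thesis
    by (simp add: solves_linear_system_def solves_explicit_ode_def rhs)
qed

section \<open>Block matrices\<close>

text \<open>This splitting of index sums is what makes products act blockwise.\<close>

lemma sum_UNIV_Plus:
  fixes g :: "'a::finite + 'b::finite \<Rightarrow> 'c::comm_monoid_add"
  shows "(\<Sum>i\<in>UNIV. g i) = (\<Sum>k\<in>UNIV. g (Inl k)) + (\<Sum>k\<in>UNIV. g (Inr k))"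
  using sum.Plus[of "UNIV :: 'a set" "UNIV :: 'b set" g] by (simp add: comp_def)

lemma block_mat_mult:
  "block_mat A B C D ** block_mat A' B' C' D' =
    block_mat (A ** A' + B ** C') (A ** B' + B ** D') (C ** A' + D ** C') (C ** B' + D ** D')"
  by (auto simp: vec_eq_iff block_mat_def matrix_matrix_mult_def sum_UNIV_Plus split: sum.split)

lemma block_mat_mult_vec:
  "block_mat A B C D *v block_vec u v = block_vec (A *v u + B *v v) (C *v u + D *v v)"
  by (auto simp: vec_eq_iff block_mat_def block_vec_def matrix_vector_mult_def sum_UNIV_Plus
      split: sum.split)

lemma block_mat_one: "block_mat (mat 1) 0 0 (mat 1) = mat 1"
  by (auto simp: vec_eq_iff block_mat_def mat_def split: sum.split)

lemma block_mat_uminus: "- block_mat A B C D = block_mat (- A) (- B) (- C) (- D)"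
  by (auto simp: vec_eq_iff block_mat_def split: sum.split)

lemma block_vec_eq_iff: "block_vec u v = block_vec u' v' \<longleftrightarrow> u = u' \<and> v = v'"
  by (auto simp: vec_eq_iff block_vec_def split: sum.splits)

lemma block_vec_cases:
  obtains u v where "x = block_vec u v"
proof
  show "x = block_vec (\<chi> k. x $ Inl k) (\<chi> k. x $ Inr k)"
    by (auto simp: vec_eq_iff block_vec_def split: sum.split)
qed

section \<open>The full-wave system in the scaled unknowns\<close>

theorem theorem1:
  fixes \<Omega> \<Omega>s :: "(real^3) set"
    and \<epsilon> \<mu> :: "real^3 \<Rightarrow> real^3^3"
    and Js :: "real \<Rightarrow> real^3 \<Rightarrow> real^3"
    and G :: "('n::finite, 'a::finite, 'b::finite, 'v::finite) primal_grid"
    and D :: "('n, 'e::finite, 'f::finite, 'v) dual_grid"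
    and ie :: "'e \<Rightarrow> 'a"
    and jf :: "'f \<Rightarrow> 'b"
    and C :: "real^'e^'f"
    and Ct :: "real^'f^'e"
    and M\<epsilon> :: "real^'e^'e"
    and M\<nu> :: "real^'f^'f"
    and js :: "real \<Rightarrow> real^'e"
    and T :: "real set"
    and t0 :: real
  assumes "lossless_maxwell_discretisation \<Omega> \<Omega>s \<epsilon> \<mu> Js G D ie jf C Ct M\<epsilon> M\<nu> js"
    and "is_interval T" and "interior T \<noteq> {}" and "t0 \<in> T"
  shows "let
      M = block_mat (matrix_inv M\<nu>) 0 0 M\<epsilon>;
      K = block_mat 0 C (- Ct) 0;
      r = (\<lambda>t. block_vec 0 (- js t));
      S\<nu> = matrix_sqrt M\<nu>;
      S\<epsilon> = matrix_sqrt M\<epsilon>;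
      to_bar = (\<lambda>(h, e). block_vec (matrix_inv S\<nu> *v h) (S\<epsilon> *v e));
      Kbar = block_mat 0 (- (S\<nu> ** C ** matrix_inv S\<epsilon>)) (matrix_inv S\<epsilon> ** Ct ** S\<nu>) 0;
      rbar = (\<lambda>t. block_vec 0 (- (matrix_inv S\<epsilon> *v js t)))
    in is_ode_system M \<and>
       bij to_bar \<and>
       (\<forall>(h :: real \<Rightarrow> real^'f) (e :: real \<Rightarrow> real^'e) h0 e0.
          solves_linear_system T M K r (\<lambda>t. block_vec (h t) (e t)) \<and>
          h t0 = h0 \<and> e t0 = e0
          \<longleftrightarrow>
          solves_explicit_ode T Kbar rbar (\<lambda>t. to_bar (h t, e t)) \<and>
          to_bar (h t0, e t0) = to_bar (h0, e0))"
proof -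
  interpret lossless_maxwell_discretisation \<Omega> \<Omega>s \<epsilon> \<mu> Js G D ie jf C Ct M\<epsilon> M\<nu> js
    by fact
  define S\<nu> where "S\<nu> = matrix_sqrt M\<nu>"
  define S\<epsilon> where "S\<epsilon> = matrix_sqrt M\<epsilon>"
  define to_bar where "to_bar = (\<lambda>(h, e). block_vec (matrix_inv S\<nu> *v h) (S\<epsilon> *v e))"
  \<comment> \<open>\<open>P\<close> is the root of the leading matrix and maps to the new unknowns;
    its first block is an inverse because the leading matrix contains
    \<open>matrix_inv M\<nu>\<close>. \<open>Q\<close> is the inverse of \<open>P\<close>.\<close>
  define P where "P = block_mat (matrix_inv S\<nu>) 0 0 S\<epsilon>"
  define Q where "Q = block_mat S\<nu> 0 0 (matrix_inv S\<epsilon>)"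
  \<comment> \<open>Definiteness of \<open>M\<nu>\<close> is conditional on that of the tensor
    \<open>\<mu>\<close> on the domain, which \<open>permeability\<close> supplies.\<close>
  have sqrt_\<nu>: "invertible S\<nu>" "S\<nu> ** S\<nu> = M\<nu>"
    using pos_def_matrix_sqrt[of M\<nu>] pos_def_invertible M\<nu> permeability
    by (auto simp: S\<nu>_def)
  have sqrt_\<epsilon>: "invertible S\<epsilon>" "S\<epsilon> ** S\<epsilon> = M\<epsilon>"
    using pos_def_matrix_sqrt[of M\<epsilon>] pos_def_invertible M\<epsilon> permittivity
    by (auto simp: S\<epsilon>_def)
  note inverses = matrix_inv_inverse[OF sqrt_\<nu>(1)] matrix_inv_inverse[OF sqrt_\<epsilon>(1)]
  have neg_mult: "(- A) ** B = - (A ** B)" "A ** (- B) = - (A ** B)"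
    for A :: "real^'x^'y" and B :: "real^'z^'x"
    by (simp_all add: vec_eq_iff matrix_matrix_mult_def sum_negf)
  have neg_vec: "A *v (- v) = - (A *v v)" for A :: "real^'x^'y" and v
    by (metis diff_0 matrix_vector_mult_0_right matrix_vector_mult_diff_distrib)
  have PQ: "P ** Q = mat 1" and QP: "Q ** P = mat 1"
    by (simp_all add: P_def Q_def block_mat_mult inverses block_mat_one)
  have PP: "block_mat (matrix_inv M\<nu>) 0 0 M\<epsilon> = P ** P"
    using matrix_inv_square[OF sqrt_\<nu>(1)] by (simp add: P_def block_mat_mult sqrt_\<nu> sqrt_\<epsilon>)
  have to_bar: "to_bar (h, e) = P *v block_vec h e" for h e
    by (simp add: to_bar_def P_def block_mat_mult_vec)
  \<comment> \<open>The sign comes from moving \<open>K\<close> to the right-hand side.\<close>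
  have Kbar: "block_mat 0 (- (S\<nu> ** C ** matrix_inv S\<epsilon>)) (matrix_inv S\<epsilon> ** Ct ** S\<nu>) 0 =
      - (Q ** block_mat 0 C (- Ct) 0 ** Q)"
    by (simp add: Q_def block_mat_mult block_mat_uminus neg_mult)
  have rbar: "block_vec 0 (- (matrix_inv S\<epsilon> *v js t)) = Q *v block_vec 0 (- js t)" for t
    by (simp add: Q_def block_mat_mult_vec neg_vec)
  \<comment> \<open>Injectivity of \<open>P\<close> makes the initial conditions in old and new
    unknowns equivalent.\<close>
  have P_inj: "P *v u = P *v v \<longleftrightarrow> u = v" for u v
    by (metis QP matrix_vector_mul_assoc matrix_vector_mul_lid)
  have "invertible (P ** P)"
    using PQ QP by (intro invertible_mult) (auto simp: invertible_def)
  moreover have "bij to_bar"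
  proof (rule bijI)
    show "inj to_bar"
      by (auto simp: inj_on_def to_bar P_inj block_vec_eq_iff)
    show "surj to_bar"
      unfolding surj_def
    proof
      fix y
      \<comment> \<open>The preimage of \<open>y\<close> is \<open>Q *v y\<close>, cut into its two
        blocks.\<close>
      obtain u v where "Q *v y = block_vec u v"
        by (rule block_vec_cases)
      then have "y = to_bar (u, v)"
        by (metis to_bar PQ matrix_vector_mul_assoc matrix_vector_mul_lid)
      then show "\<exists>p. y = to_bar p"
        by blast
    qed
  qed
  ultimately show ?thesis
    unfolding Let_def S\<nu>_def[symmetric] S\<epsilon>_def[symmetric] to_bar_def[symmetric] PP Kbar rbar
    by (simp add: is_ode_system_def is_dae_system_def to_bar P_inj block_vec_eq_iff
        solves_linear_system_iff_explicit[OF PQ QP])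
qed

end
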